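(* Let $S$ be a (Tychonoff) topological semigroup whose underlying space is openly factorizable and whose square $S\times S$ is weakly Lindelöf. Then the semigroup operation $S\times S\to S$ extends to a (jointly) continuous semigroup operation $\upsilon S\times\upsilon S\to\upsilon S$ defined on the Hewitt completion $\upsilon S$ of $S$.
   Context: All topological spaces are assumed to be Tychonoff. A topological semigroup is a topological space endowed with a jointly continuous associative binary operation. A space $X$ is openly factorizable if for each continuous map $f:X\to Y$ to a second countable space $Y$ there are a continuous open map $p:X\to Z$ onto a second countable space $Z$ and a continuous map $g:Z\to Y$ such that $f=g\circ p$. A space $X$ is weakly Lindelöf if each open cover $\mathcal U$ of $X$ contains a countable subcollection $\mathcal V\subset\mathcal U$ whose union $\bigcup\mathcal V$ is dense in $X$. A space is real complete if it is homeomorphic to a closed subspace of some power $\mathbb R^\kappa$ of the real line. The Hewitt completion $\upsilon X$ of a Tychonoff space $X$ is a real complete space containing $X$ as a dense subspace such that each continuous map from $X$ to a real complete space $Y$ extends to a continuous map $\upsilon X\to Y$. *)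

theory Defs
  imports "HOL-Analysis.Analysis"
begin

definition Tychonoff_space :: "'a topology \<Rightarrow> bool" where
  "Tychonoff_space X \<longleftrightarrow> completely_regular_space X \<and> Hausdorff_space X"

definition topological_semigroup :: "'a topology \<Rightarrow> ('a \<Rightarrow> 'a \<Rightarrow> 'a) \<Rightarrow> bool" where
  "topological_semigroup X m \<longleftrightarrow>
     Tychonoff_space X \<and>
     continuous_map (prod_topology X X) X (\<lambda>(x, y). m x y) \<and>
     (\<forall>x \<in> topspace X. \<forall>y \<in> topspace X. \<forall>z \<in> topspace X. m (m x y) z = m x (m y z))"

definition weakly_Lindelof_space :: "'a topology \<Rightarrow> bool" where
  "weakly_Lindelof_space X \<longleftrightarrow>
     (\<forall>\<U>. (\<forall>U \<in> \<U>. openin X U) \<and> \<Union>\<U> = topspace X \<longrightarrow>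
        (\<exists>\<V> \<subseteq> \<U>. countable \<V> \<and> X closure_of (\<Union>\<V>) = topspace X))"

text \<open>
  HOL cannot quantify over types inside a definition, so the spaces ranging over "all" spaces
  in the next definitions live on fixed types that are large enough to lose no generality.
  A second countable Tychonoff space has at most continuum many points, so up to homeomorphism
  it is a topology on a set of reals; see \<open>openly_factorizable_spaceD\<close> and
  \<open>openly_factorizable_spaceI\<close> below.
\<close>

definition openly_factorizable_space :: "'a topology \<Rightarrow> bool" where
  "openly_factorizable_space X \<longleftrightarrow>
     (\<forall>(Y :: real topology) f.
        Tychonoff_space Y \<and> second_countable Y \<and> continuous_map X Y f \<longrightarrow>
        (\<exists>(Z :: real topology) p g.
           Tychonoff_space Z \<and> second_countable Z \<and>
           continuous_map X Z p \<and> open_map X Z p \<and> p ` topspace X = topspace Z \<and>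
           continuous_map Z Y g \<and> (\<forall>x \<in> topspace X. f x = g (p x))))"

text \<open>
  Coordinates of a closed embedding of \<open>X\<close> into a power of the line that agree as functions
  on \<open>X\<close> may be identified, so exponents that are sets of real functions on \<open>X\<close> suffice;
  see \<open>real_complete_spaceI\<close>.
\<close>

definition real_complete_space :: "'a topology \<Rightarrow> bool" where
  "real_complete_space X \<longleftrightarrow>
     (\<exists>(I :: ('a \<Rightarrow> real) set) A.
        closedin (product_topology (\<lambda>_. euclideanreal) I) A \<and>
        X homeomorphic_space subtopology (product_topology (\<lambda>_. euclideanreal) I) A)"

text \<open>
  \<open>U\<close> is a Hewitt completion of \<open>X\<close>, where \<open>X\<close> is regarded as a subspace of \<open>U\<close> along the
  embedding \<open>e\<close>.  The test spaces \<open>Y\<close> again live on a fixed type; that the extension property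
  then holds for real complete spaces on every type is \<open>Hewitt_completion_extend\<close>.
\<close>

definition Hewitt_completion :: "'a topology \<Rightarrow> 'b topology \<Rightarrow> ('a \<Rightarrow> 'b) \<Rightarrow> bool" where
  "Hewitt_completion X U e \<longleftrightarrow>
     real_complete_space U \<and>
     embedding_map X U e \<and> U closure_of (e ` topspace X) = topspace U \<and>
     (\<forall>(Y :: (('a \<Rightarrow> real) \<Rightarrow> real) topology) f.
        real_complete_space Y \<and> continuous_map X Y f \<longrightarrow>
        (\<exists>g. continuous_map U Y g \<and> (\<forall>x \<in> topspace X. g (e x) = f x)))"

subsection \<open>Independence of the chosen types\<close>

lemma embedding_map_factor:
  assumes k: "embedding_map X Y k" and d: "continuous_map X W d"
    and \<phi>: "continuous_map W Y \<phi>" and eq: "\<And>x. x \<in> topspace X \<Longrightarrow> \<phi> (d x) = k x"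
  shows "embedding_map X W d"
proof -
  obtain k' where k': "homeomorphic_maps X (subtopology Y (k ` topspace X)) k k'"
    using k by (auto simp: embedding_map_def homeomorphic_map_maps)
  have c: "continuous_map (subtopology W (d ` topspace X)) (subtopology Y (k ` topspace X)) \<phi>"
    using \<phi> eq by (auto simp: continuous_map_in_subtopology continuous_map_from_subtopology)
  have "continuous_map (subtopology W (d ` topspace X)) X (k' \<circ> \<phi>)"
    using c k' continuous_map_compose homeomorphic_maps_def by blast
  then have "homeomorphic_maps X (subtopology W (d ` topspace X)) d (k' \<circ> \<phi>)"
    using d k' eq unfolding homeomorphic_maps_def
    by (auto simp: continuous_map_in_subtopology)
  then show ?thesis
    unfolding embedding_map_def homeomorphic_map_maps by blast
qed

lemma real_complete_space_closed_embedding: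
  fixes X :: "'a topology" and I :: "'i set"
  assumes e: "embedding_map X (product_topology (\<lambda>_. euclideanreal) I) e"
    and cl: "closedin (product_topology (\<lambda>_. euclideanreal) I) (e ` topspace X)"
  shows "real_complete_space X"
proof -
  define r where "r = (\<lambda>i x. if x \<in> topspace X then e x i else (0::real))"
  define J where "J = r ` I"
  define d where "d = (\<lambda>x. \<lambda>j\<in>J. j x)"
  define \<phi> where "\<phi> = (\<lambda>y. \<lambda>i\<in>I. (y (r i) :: real))"
  let ?RI = "product_topology (\<lambda>_. euclideanreal) I"
  let ?RJ = "product_topology (\<lambda>_. euclideanreal) J"
  have ec: "continuous_map X ?RI e"
    using e by (simp add: embedding_map_def homeomorphic_imp_continuous_map continuous_map_in_subtopology
        homeomorphic_eq_everything_map)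
  have ex: "e x \<in> extensional I" if "x \<in> topspace X" for x
    using ec that by (auto simp: continuous_map_componentwise)
  have dc: "continuous_map X ?RJ d"
    unfolding continuous_map_componentwise
  proof (intro conjI ballI)
    fix j assume "j \<in> J"
    then obtain i where i: "i \<in> I" "j = r i" by (auto simp: J_def)
    have "continuous_map X euclideanreal (\<lambda>x. e x i)"
      using ec i by (auto simp: continuous_map_componentwise)
    then show "continuous_map X euclideanreal (\<lambda>x. d x j)"
      by (rule continuous_map_eq) (use i \<open>j \<in> J\<close> in \<open>auto simp: d_def r_def\<close>)
  qed (auto simp: d_def)
  have \<phi>c: "continuous_map ?RJ ?RI \<phi>"
    unfolding continuous_map_componentwise
  proof (intro conjI ballI)
    fix i assume i: "i \<in> I"
    then have "continuous_map ?RJ euclideanreal (\<lambda>y. y (r i))"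
      by (intro continuous_map_product_projection) (auto simp: J_def)
    then show "continuous_map ?RJ euclideanreal (\<lambda>y. \<phi> y i)"
      by (rule continuous_map_eq) (use i in \<open>auto simp: \<phi>_def\<close>)
  qed (auto simp: \<phi>_def)
  have eq: "\<phi> (d x) = e x" if "x \<in> topspace X" for x
    using ex[OF that] that by (auto simp: \<phi>_def d_def J_def r_def extensional_def fun_eq_iff)
  have inj: "y = z" if "y \<in> topspace ?RJ" "z \<in> topspace ?RJ" "\<phi> y = \<phi> z" for y z
  proof (rule extensionalityI)
    fix j assume "j \<in> J"
    then obtain i where i: "i \<in> I" "j = r i" by (auto simp: J_def)
    then show "y j = z j" using fun_cong[OF that(3), of i] by (simp add: \<phi>_def)
  qed (use that in \<open>auto simp: PiE_iff\<close>)
  have emb: "embedding_map X ?RJ d"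
    by (rule embedding_map_factor[OF e dc \<phi>c]) (rule eq)
  have "d ` topspace X = {y \<in> topspace ?RJ. \<phi> y \<in> e ` topspace X}"
  proof (intro set_eqI iffI)
    fix y assume "y \<in> d ` topspace X"
    then show "y \<in> {y \<in> topspace ?RJ. \<phi> y \<in> e ` topspace X}"
      using dc eq continuous_map_funspace by fastforce
  next
    fix y assume y: "y \<in> {y \<in> topspace ?RJ. \<phi> y \<in> e ` topspace X}"
    then obtain x where x: "x \<in> topspace X" "\<phi> y = e x" by auto
    moreover have "d x \<in> topspace ?RJ" using dc x continuous_map_funspace by fastforce
    ultimately have "y = d x" using y eq inj by auto
    then show "y \<in> d ` topspace X" using x by blast
  qed
  then have "closedin ?RJ (d ` topspace X)"
    using closedin_continuous_map_preimage[OF \<phi>c cl] by simp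
  then show ?thesis
    unfolding real_complete_space_def using embedding_map_imp_homeomorphic_space[OF emb] by blast
qed

lemma real_complete_spaceI:
  fixes X :: "'a topology" and I :: "'i set"
  assumes A: "closedin (product_topology (\<lambda>_. euclideanreal) I) A"
    and h: "X homeomorphic_space subtopology (product_topology (\<lambda>_. euclideanreal) I) A"
  shows "real_complete_space X"
proof -
  let ?RI = "product_topology (\<lambda>_. euclideanreal) I"
  obtain e where e: "homeomorphic_map X (subtopology ?RI A) e"
    using h homeomorphic_space by blast
  have im: "e ` topspace X = A"
    using homeomorphic_imp_surjective_map[OF e] closedin_subset[OF A] by auto
  have "embedding_map X ?RI e"
    using e im by (simp add: embedding_map_def)
  then show ?thesis
    using real_complete_space_closed_embedding im A by metis
qed

lemma real_complete_space_Tychonoff: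
  assumes "real_complete_space X" shows "Tychonoff_space X"
proof -
  obtain I :: "('a \<Rightarrow> real) set" and A where
    h: "X homeomorphic_space subtopology (product_topology (\<lambda>_. euclideanreal) I) A"
    using assms by (auto simp: real_complete_space_def)
  have "completely_regular_space (subtopology (product_topology (\<lambda>_. euclideanreal) I) A)"
    by (intro completely_regular_space_subtopology)
       (simp add: completely_regular_space_product_topology metrizable_imp_completely_regular_space
         metrizable_space_euclidean)
  moreover have "Hausdorff_space (subtopology (product_topology (\<lambda>_. euclideanreal) I) A)"
    by (intro Hausdorff_space_subtopology) (simp add: Hausdorff_space_product_topology)
  ultimately show ?thesis
    using h homeomorphic_completely_regular_space homeomorphic_Hausdorff_space
    unfolding Tychonoff_space_def by blast
qed

lemma real_complete_space_line:
  "real_complete_space (product_topology (\<lambda>_. euclideanreal) {i :: 'i})"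
  by (rule real_complete_spaceI[of "{i}" "topspace (product_topology (\<lambda>_. euclideanreal) {i})"])
     (auto simp: subtopology_topspace homeomorphic_space_refl simp del: topspace_product_topology)

lemma Hewitt_completionD:
  fixes X :: "'a topology" and Y :: "(('a \<Rightarrow> real) \<Rightarrow> real) topology"
  assumes "Hewitt_completion X U e" "real_complete_space Y" "continuous_map X Y f"
  shows "\<exists>g. continuous_map U Y g \<and> (\<forall>x \<in> topspace X. g (e x) = f x)"
  using assms unfolding Hewitt_completion_def by (elim conjE) (drule spec, drule spec, erule mp, rule conjI)

lemma Hewitt_completion_extend_real:
  assumes H: "Hewitt_completion X U e" and f: "continuous_map X euclideanreal f"
  shows "\<exists>g. continuous_map U euclideanreal g \<and> (\<forall>x \<in> topspace X. g (e x) = f x)"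
proof -
  let ?Y = "product_topology (\<lambda>_. euclideanreal) {undefined :: 'a \<Rightarrow> real}"
  have "continuous_map X ?Y (\<lambda>x. \<lambda>i\<in>{undefined}. f x)"
    using f by (auto simp: continuous_map_componentwise)
  with H have "\<exists>g. continuous_map U ?Y g \<and> (\<forall>x \<in> topspace X. g (e x) = (\<lambda>i\<in>{undefined}. f x))"
    by (intro Hewitt_completionD real_complete_space_line)
  then obtain g where g: "continuous_map U ?Y g"
    "\<And>x. x \<in> topspace X \<Longrightarrow> g (e x) = (\<lambda>i\<in>{undefined}. f x)"
    by auto
  then have "continuous_map U euclideanreal (\<lambda>u. g u undefined)"
    by (auto simp: continuous_map_componentwise)
  then show ?thesis using g(2) by (intro exI[of _ "\<lambda>u. g u undefined"]) auto
qed

text \<open>Extending the coordinates suffices for extending maps into a real complete space.\<close>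

lemma extend_into_real_complete:
  fixes Y :: "'c topology"
  assumes Y: "real_complete_space Y" and f: "continuous_map X Y f"
    and dense: "U closure_of (e ` topspace X) = topspace U"
    and sub: "e ` topspace X \<subseteq> topspace U"
    and ext: "\<And>h. continuous_map X euclideanreal h \<Longrightarrow>
       \<exists>g. continuous_map U euclideanreal g \<and> (\<forall>x \<in> topspace X. g (e x) = h x)"
  shows "\<exists>g. continuous_map U Y g \<and> (\<forall>x \<in> topspace X. g (e x) = f x)"
proof -
  obtain I A where A: "closedin (product_topology (\<lambda>_. euclideanreal) (I :: ('c \<Rightarrow> real) set)) A"
    and "Y homeomorphic_space subtopology (product_topology (\<lambda>_. euclideanreal) I) A"
    using Y unfolding real_complete_space_def by (elim exE conjE) (erule that)
  then obtain h h' where hh: "homeomorphic_maps Y (subtopology (product_topology (\<lambda>_. euclideanreal) I) A) h h'"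
    by (auto simp: homeomorphic_space_def)
  let ?RI = "product_topology (\<lambda>_. euclideanreal) I"
  have hf: "continuous_map X (subtopology ?RI A) (h \<circ> f)"
    using hh f continuous_map_compose unfolding homeomorphic_maps_def by blast
  then have hfc: "continuous_map X ?RI (h \<circ> f)" and hfA: "\<And>x. x \<in> topspace X \<Longrightarrow> h (f x) \<in> A"
    by (auto simp: continuous_map_in_subtopology)
  have hfi: "continuous_map X euclideanreal (\<lambda>x. h (f x) i)" if "i \<in> I" for i
    using hfc that by (auto simp: continuous_map_componentwise)
  have hfe: "h (f x) \<in> extensional I" if "x \<in> topspace X" for x
    using hfc that by (auto simp: continuous_map_componentwise)
  obtain G where G: "\<And>i. i \<in> I \<Longrightarrow> continuous_map U euclideanreal (G i)"
    "\<And>i x. i \<in> I \<Longrightarrow> x \<in> topspace X \<Longrightarrow> G i (e x) = h (f x) i"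
    using ext[OF hfi] by metis
  define k where "k = (\<lambda>u. \<lambda>i\<in>I. G i u)"
  have kc: "continuous_map U ?RI k"
    using G(1) by (auto simp: continuous_map_componentwise k_def)
  have ke: "k (e x) = h (f x)" if "x \<in> topspace X" for x
    using G(2) that hfe[OF that] by (auto simp: k_def extensional_def fun_eq_iff)
  have "k ` topspace U \<subseteq> A"
  proof -
    have "closedin U {u \<in> topspace U. k u \<in> A}"
      using closedin_continuous_map_preimage[OF kc A] .
    moreover have "e ` topspace X \<subseteq> {u \<in> topspace U. k u \<in> A}"
      using sub ke hfA by auto
    ultimately show ?thesis using dense closure_of_minimal by blast
  qed
  then have "continuous_map U (subtopology ?RI A) k"
    using kc by (simp add: continuous_map_in_subtopology image_subset_iff_funcset)
  then have "continuous_map U Y (h' \<circ> k)"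
    using hh continuous_map_compose unfolding homeomorphic_maps_def by blast
  moreover have "h' (k (e x)) = f x" if "x \<in> topspace X" for x
    using ke[OF that] hh f that continuous_map_funspace unfolding homeomorphic_maps_def by fastforce
  ultimately show ?thesis by (intro exI[of _ "h' \<circ> k"]) auto
qed

lemma Hewitt_completion_extend:
  fixes Y :: "'c topology"
  assumes H: "Hewitt_completion X U e" and "real_complete_space Y" and "continuous_map X Y f"
  shows "\<exists>g. continuous_map U Y g \<and> (\<forall>x \<in> topspace X. g (e x) = f x)"
proof (rule extend_into_real_complete[OF assms(2,3)])
  show "U closure_of (e ` topspace X) = topspace U"
    using H by (simp add: Hewitt_completion_def)
  then show "e ` topspace X \<subseteq> topspace U"
    using H by (auto simp: Hewitt_completion_def embedding_map_def homeomorphic_eq_everything_map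
        continuous_map_in_subtopology continuous_map_def)
qed (rule Hewitt_completion_extend_real[OF H])

text \<open>The notion is inhabited: every Tychonoff space has a Hewitt completion.\<close>

lemma Hewitt_completion_exists:
  fixes X :: "'a topology"
  assumes X: "Tychonoff_space X"
  shows "\<exists>(U :: (('a \<Rightarrow> real) \<Rightarrow> real) topology) e. Hewitt_completion X U e"
proof -
  define C where "C = {f. continuous_map X euclideanreal f}"
  define d where "d = (\<lambda>x. \<lambda>f\<in>C. f x)"
  let ?R = "product_topology (\<lambda>_. euclideanreal) C"
  define U where "U = subtopology ?R (?R closure_of (d ` topspace X))"
  define K where "K = mspace (submetric (cfunspace X euclidean_metric) {f. f \<in> topspace X \<rightarrow> {0..1::real}})"
  have KC: "K \<subseteq> C" by (auto simp: K_def C_def)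
  have k: "embedding_map X (product_topology (\<lambda>f. top_of_set {0..1::real}) K) (\<lambda>x. \<lambda>f\<in>K. f x)"
    using completely_regular_space_cube_embedding_explicit X
    unfolding Tychonoff_space_def K_def by blast
  have k: "embedding_map X (product_topology (\<lambda>f. euclideanreal) K) (\<lambda>x. \<lambda>f\<in>K. f x)"
    using k by (simp add: embedding_map_in_subtopology flip: subtopology_product_topology)
  have dc: "continuous_map X ?R d"
    by (auto simp: continuous_map_componentwise d_def C_def)
  have emb: "embedding_map X ?R d"
  proof (rule embedding_map_factor[OF k dc])
    show "continuous_map ?R (product_topology (\<lambda>f. euclideanreal) K) (\<lambda>y. restrict y K)"
      using KC by (auto simp: continuous_map_componentwise intro!: continuous_map_product_projection)
  qed (use KC in \<open>auto simp: d_def inf_absorb2\<close>)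
  have dsub: "d ` topspace X \<subseteq> topspace ?R"
    using dc continuous_map_image_subset_topspace by blast
  have dcl: "d ` topspace X \<subseteq> ?R closure_of (d ` topspace X)"
    using closure_of_subset[OF dsub] .
  have tU: "topspace U = ?R closure_of (d ` topspace X)"
    using closure_of_subset_topspace[of ?R "d ` topspace X"] by (auto simp: U_def)
  have rc: "real_complete_space U"
    by (rule real_complete_spaceI[of C "?R closure_of (d ` topspace X)"])
       (auto simp: U_def homeomorphic_space_refl)
  have embU: "embedding_map X U d"
    using emb dcl by (simp add: U_def embedding_map_in_subtopology)
  have dense: "U closure_of (d ` topspace X) = topspace U"
    unfolding tU unfolding U_def using dcl by (simp add: closure_of_subtopology inf_absorb2)
  have "\<exists>g. continuous_map U Y g \<and> (\<forall>x \<in> topspace X. g (d x) = f x)"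
    if "real_complete_space Y" "continuous_map X Y f" for Y :: "(('a \<Rightarrow> real) \<Rightarrow> real) topology" and f
  proof (rule extend_into_real_complete[OF that dense])
    show "d ` topspace X \<subseteq> topspace U" using dcl tU by simp
    fix h assume h: "continuous_map X euclideanreal h"
    then have "h \<in> C" by (simp add: C_def)
    then show "\<exists>g. continuous_map U euclideanreal g \<and> (\<forall>x \<in> topspace X. g (d x) = h x)"
      by (intro exI[of _ "\<lambda>u. u h"])
         (auto simp: U_def d_def intro!: continuous_map_from_subtopology continuous_map_product_projection)
  qed
  then show ?thesis
    using rc embU dense unfolding Hewitt_completion_def by blast
qed

lemma second_countable_homeomorphic_real:
  fixes Y :: "'b topology"
  assumes T: "Tychonoff_space Y" and sc: "second_countable Y"
  shows "\<exists>(Y' :: real topology) h h'. Tychonoff_space Y' \<and> second_countable Y' \<and> homeomorphic_maps Y Y' h h'"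
proof -
  obtain \<B> where \<B>: "countable \<B>" "\<And>V. V \<in> \<B> \<Longrightarrow> openin Y V"
    "\<And>W x. openin Y W \<Longrightarrow> x \<in> W \<Longrightarrow> \<exists>V \<in> \<B>. x \<in> V \<and> V \<subseteq> W"
    using sc unfolding second_countable_def by metis
  define c where "c = (\<lambda>x. to_nat_on \<B> ` {V \<in> \<B>. x \<in> V})"
  obtain b :: "nat set \<Rightarrow> real" where b: "inj b"
    using nat_sets_eqpoll_reals by (auto simp: eqpoll_def bij_betw_def)
  define h where "h = b \<circ> c"
  have injc: "inj_on c (topspace Y)"
  proof (rule inj_onI, rule ccontr)
    fix x y assume xy: "x \<in> topspace Y" "y \<in> topspace Y" "c x = c y" "x \<noteq> y"
    then obtain W where W: "openin Y W" "x \<in> W" "y \<notin> W"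
      using T unfolding Tychonoff_space_def Hausdorff_space_def disjnt_iff by metis
    then obtain V where V: "V \<in> \<B>" "x \<in> V" "y \<notin> V" using \<B>(3) by blast
    have "{V \<in> \<B>. x \<in> V} = {V \<in> \<B>. y \<in> V}"
      using xy(3) inj_on_to_nat_on[OF \<B>(1)] unfolding c_def
      by (subst (asm) inj_on_image_eq_iff[of _ \<B>]) auto
    then show False using V by blast
  qed
  have inj: "inj_on h (topspace Y)"
    unfolding h_def using injc b by (simp add: comp_inj_on inj_on_subset)
  define h' where "h' = inv_into (topspace Y) h"
  define Y' where "Y' = pullback_topology (h ` topspace Y) h' Y"
  have h'h: "h' (h x) = x" if "x \<in> topspace Y" for x
    using that inj by (simp add: h'_def)
  have hm: "homeomorphic_maps Y Y' h h'"
    unfolding homeomorphic_maps_def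
  proof (intro conjI ballI)
    show "continuous_map Y Y' h"
      unfolding Y'_def
    proof (rule continuous_map_pullback')
      show "continuous_map Y Y (h' \<circ> h)"
        by (rule continuous_map_eq[OF continuous_map_id]) (auto simp: h'h)
    qed auto
    have "continuous_map Y' Y (id \<circ> h')"
      unfolding Y'_def by (rule continuous_map_pullback) (rule continuous_map_id)
    then show "continuous_map Y' Y h'" by simp
  qed (auto simp: Y'_def topspace_pullback_topology h'h)
  have hom: "Y homeomorphic_space Y'" using hm homeomorphic_space_def by blast
  have "Tychonoff_space Y'"
    using T hom homeomorphic_completely_regular_space homeomorphic_Hausdorff_space
    unfolding Tychonoff_space_def by blast
  moreover have "second_countable Y'"
    using hm sc by (meson homeomorphic_map_maps homeomorphic_imp_continuous_map homeomorphic_imp_open_map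
        homeomorphic_imp_surjective_map second_countable_open_map_image)
  ultimately show ?thesis using hm by blast
qed

lemma openly_factorizable_spaceD:
  fixes X :: "'a topology" and Y :: "'b topology"
  assumes X: "openly_factorizable_space X"
    and Y: "Tychonoff_space Y" "second_countable Y" and f: "continuous_map X Y f"
  shows "\<exists>(Z :: real topology) p g.
           Tychonoff_space Z \<and> second_countable Z \<and>
           continuous_map X Z p \<and> open_map X Z p \<and> p ` topspace X = topspace Z \<and>
           continuous_map Z Y g \<and> (\<forall>x \<in> topspace X. f x = g (p x))"
proof -
  obtain Y' :: "real topology" and h h' where Y': "Tychonoff_space Y'" "second_countable Y'"
    and hh: "homeomorphic_maps Y Y' h h'"
    using second_countable_homeomorphic_real[OF Y] by blast
  have "continuous_map X Y' (h \<circ> f)"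
    using f hh continuous_map_compose unfolding homeomorphic_maps_def by blast
  with X Y' have "\<exists>(Z :: real topology) p g.
           Tychonoff_space Z \<and> second_countable Z \<and>
           continuous_map X Z p \<and> open_map X Z p \<and> p ` topspace X = topspace Z \<and>
           continuous_map Z Y' g \<and> (\<forall>x \<in> topspace X. (h \<circ> f) x = g (p x))"
    unfolding openly_factorizable_space_def
    by - (drule spec, drule spec, erule mp, intro conjI)
  then obtain Z :: "real topology" and p g where Z: "Tychonoff_space Z" "second_countable Z"
    "continuous_map X Z p" "open_map X Z p" "p ` topspace X = topspace Z"
    and g: "continuous_map Z Y' g" "\<And>x. x \<in> topspace X \<Longrightarrow> (h \<circ> f) x = g (p x)"
    by (elim exE conjE) (rule that; (assumption | erule bspec))
  have 1: "continuous_map Z Y (h' \<circ> g)"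
    using g hh continuous_map_compose unfolding homeomorphic_maps_def by blast
  have 2: "f x = (h' \<circ> g) (p x)" if "x \<in> topspace X" for x
  proof -
    have "f x \<in> topspace Y" using f that continuous_map_funspace by fastforce
    then have "h' (h (f x)) = f x" using hh by (simp add: homeomorphic_maps_def)
    then show ?thesis using g(2)[OF that] by simp
  qed
  show ?thesis
    by (intro exI conjI ballI) (rule Z 1 2; assumption?)+
qed

lemma openly_factorizable_spaceI:
  fixes X :: "'a topology"
  assumes *: "\<And>(Y :: real topology) f.
        Tychonoff_space Y \<Longrightarrow> second_countable Y \<Longrightarrow> continuous_map X Y f \<Longrightarrow>
        \<exists>(Z :: 'c topology) p g.
           Tychonoff_space Z \<and> second_countable Z \<and>
           continuous_map X Z p \<and> open_map X Z p \<and> p ` topspace X = topspace Z \<and>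
           continuous_map Z Y g \<and> (\<forall>x \<in> topspace X. f x = g (p x))"
  shows "openly_factorizable_space X"
  unfolding openly_factorizable_space_def
proof (intro allI impI, elim conjE)
  fix Y :: "real topology" and f
  assume "Tychonoff_space Y" "second_countable Y" "continuous_map X Y f"
  from *[OF this] obtain Z :: "'c topology" and p g where Z: "Tychonoff_space Z" "second_countable Z"
    and p: "continuous_map X Z p" "open_map X Z p" "p ` topspace X = topspace Z"
    and g: "continuous_map Z Y g" "\<And>x. x \<in> topspace X \<Longrightarrow> f x = g (p x)"
    by (elim exE conjE) (rule that; (assumption | erule bspec))
  obtain Z' :: "real topology" and h h' where Z': "Tychonoff_space Z'" "second_countable Z'"
    and hh: "homeomorphic_maps Z Z' h h'"
    using second_countable_homeomorphic_real[OF Z] by blast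
  have hm: "homeomorphic_map Z Z' h" using hh homeomorphic_map_maps by blast
  have 1: "continuous_map X Z' (h \<circ> p)" "open_map X Z' (h \<circ> p)" "(h \<circ> p) ` topspace X = topspace Z'"
    using continuous_map_compose[OF p(1) homeomorphic_imp_continuous_map[OF hm]]
      open_map_compose[OF p(2) homeomorphic_imp_open_map[OF hm]]
      p(3) homeomorphic_imp_surjective_map[OF hm]
    by (simp_all only: image_comp[symmetric])
  have 2: "continuous_map Z' Y (g \<circ> h')"
    using g hh continuous_map_compose unfolding homeomorphic_maps_def by blast
  have 3: "f x = (g \<circ> h') ((h \<circ> p) x)" if "x \<in> topspace X" for x
  proof -
    have "p x \<in> topspace Z" using p(3) that by blast
    then show ?thesis using g(2)[OF that] hh by (simp add: homeomorphic_maps_def)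
  qed
  show "\<exists>(Z :: real topology) p g.
           Tychonoff_space Z \<and> second_countable Z \<and>
           continuous_map X Z p \<and> open_map X Z p \<and> p ` topspace X = topspace Z \<and>
           continuous_map Z Y g \<and> (\<forall>x \<in> topspace X. f x = g (p x))"
    by (intro exI conjI ballI) (rule Z' 1 2 3; assumption?)+
qed

end

theory Submission
  imports Defs
begin

text \<open>
  A Hewitt completion comes with extensions of maps of \<open>S\<close>, whereas the operation is a map of
  \<open>S \<times> S\<close>, and in general \<open>\<upsilon>(S \<times> S)\<close> differs from \<open>\<upsilon>S \<times> \<upsilon>S\<close>.  The two hypotheses
  on \<open>S\<close> overcome this by reducing real functions of two variables to maps of one variable: every
  continuous \<open>f : S \<times> S \<rightarrow> \<real>\<close> can be written \<open>f = g \<circ> (p \<times> p)\<close> with a continuous map \<open>p\<close> of \<open>S\<close> to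
  a second countable space \<open>Z\<close> and a continuous \<open>g : Z \<times> Z \<rightarrow> \<real>\<close>
  (\<open>square_function_factors\<close>).  Second countable Tychonoff spaces are real complete, so that \<open>p\<close>
  extends to \<open>p' : \<upsilon>S \<rightarrow> Z\<close> (\<open>extend_into_second_countable\<close>), and \<open>g \<circ> (p' \<times> p')\<close> extends \<open>f\<close>.
  Since a map into the real complete space \<open>\<upsilon>S\<close> is extended coordinatewise, the operation
  extends too, and associativity passes from the dense subsemigroup \<open>S\<close> to \<open>\<upsilon>S\<close>.

  To factor \<open>f\<close>, cover \<open>S \<times> S\<close>, for each \<open>n\<close>, by boxes with cozero sides on which \<open>f\<close>
  oscillates by less than \<open>1/(n+1)\<close>.  Weak Lindelofness leaves countably many boxes with a dense union,
  and their sides are described by countably many real functions.  Open factorizability gives an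
  open map \<open>p\<close> through which all these functions factor, which makes the boxes saturated for
  \<open>p \<times> p\<close>.  The union of the boxes may miss points of \<open>S \<times> S\<close>; openness of \<open>p \<times> p\<close> makes up for
  this.  If \<open>a\<close> and \<open>b\<close> lie in the same fibre, then the fibres which
  meet given neighbourhoods of both points fill a nonempty open set, and so one of them lies in a
  box of small oscillation (\<open>constant_on_fibres_of_open_map\<close>).  Hence \<open>f\<close> is constant on the fibres of
  the quotient map \<open>p \<times> p\<close>.
\<close>

section \<open>Maps into second countable spaces\<close>

text \<open>
  The Urysohn embedding.  A base is countable, so it suffices to choose one function for each pair
  of basic sets \<open>V\<close>, \<open>W\<close> that some function separates; here separation of \<open>V\<close> from the complement
  of \<open>W\<close> means \<open>u < 1\<close> on \<open>V\<close> and \<open>u = 1\<close> off \<open>W\<close>, so that any function vanishing at a point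
  and equal to 1 off \<open>W\<close> provides a suitable \<open>V\<close> around that point.
\<close>

lemma second_countable_embeds_in_real_sequences:
  fixes Z :: "'a topology"
  assumes Z: "Tychonoff_space Z" "second_countable Z"
  shows "\<exists>k :: 'a \<Rightarrow> nat \<Rightarrow> real. embedding_map Z euclidean k"
proof -
  obtain \<B> where \<B>: "countable \<B>" "\<And>V. V \<in> \<B> \<Longrightarrow> openin Z V"
    "\<And>W x. openin Z W \<Longrightarrow> x \<in> W \<Longrightarrow> \<exists>V \<in> \<B>. x \<in> V \<and> V \<subseteq> W"
    using Z(2) unfolding second_countable_def by metis
  define sep where "sep = (\<lambda>V W u. continuous_map Z euclideanreal u \<and>
    (\<forall>z \<in> V. u z < 1) \<and> (\<forall>z \<in> topspace Z - W. u z = 1))"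
  define P where "P = {(V, W) \<in> \<B> \<times> \<B>. \<exists>u. sep V W u}"
  define c where "c = (\<lambda>(V, W). SOME u. sep V W u)"
  define \<Phi> where "\<Phi> = insert (\<lambda>_. 0) (c ` P)"
  define k where "k = (\<lambda>z n. from_nat_into \<Phi> n z)"
  have "countable P"
    by (rule countable_subset[of _ "\<B> \<times> \<B>"]) (use \<B>(1) in \<open>auto simp: P_def\<close>)
  then have cnt: "countable \<Phi>" by (simp add: \<Phi>_def)
  have c: "sep V W (c (V, W))" if "(V, W) \<in> P" for V W
  proof -
    have "\<exists>u. sep V W u" using that by (simp add: P_def)
    then have "sep V W (SOME u. sep V W u)" by (rule someI_ex)
    then show ?thesis by (simp add: c_def)
  qed
  have cont: "continuous_map Z euclideanreal u" if "u \<in> \<Phi>" for u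
    using that c by (auto simp: \<Phi>_def sep_def)
  have kc: "continuous_map Z euclidean k"
    unfolding euclidean_product_topology [symmetric] continuous_map_componentwise_UNIV k_def
    by (intro allI cont) (rule from_nat_into, simp add: \<Phi>_def)
  have sepr: "\<exists>n. k z n < 1 \<and> (\<forall>y \<in> topspace Z - W. k y n = 1)" if W: "openin Z W" "z \<in> W" for W z
  proof -
    obtain W' where W': "W' \<in> \<B>" "z \<in> W'" "W' \<subseteq> W" using \<B>(3)[OF W] by blast
    then obtain u where u: "continuous_map Z euclideanreal u" "u z = 0" "u ` (topspace Z - W') \<subseteq> {1}"
      using Z(1) \<B>(2) unfolding Tychonoff_space_def completely_regular_space_alt' by meson
    have "openin Z {x \<in> topspace Z. u x \<in> {..<1}}"
      using u(1) by (rule openin_continuous_map_preimage) auto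
    moreover have "z \<in> topspace Z" using W openin_subset by blast
    ultimately obtain V where V: "V \<in> \<B>" "z \<in> V" "V \<subseteq> {x \<in> topspace Z. u x \<in> {..<1}}"
      using \<B>(3)[of "{x \<in> topspace Z. u x \<in> {..<1}}" z] u(2) by auto
    have "sep V W' u" using u V by (auto simp: sep_def)
    with V W' have VW: "(V, W') \<in> P" by (auto simp: P_def)
    then have "c (V, W') \<in> \<Phi>" by (simp add: \<Phi>_def)
    then obtain n where n: "from_nat_into \<Phi> n = c (V, W')"
      using from_nat_into_surj[OF cnt] by metis
    show ?thesis
      using c[OF VW] V(2) W'(3) by (intro exI[of _ n]) (auto simp: sep_def k_def n)
  qed
  have inj: "inj_on k (topspace Z)"
  proof (rule inj_onI, rule ccontr)
    fix x y assume xy: "x \<in> topspace Z" "y \<in> topspace Z" "k x = k y" "x \<noteq> y"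
    then obtain W where "openin Z W" "x \<in> W" "y \<notin> W"
      using Z(1) unfolding Tychonoff_space_def Hausdorff_space_def disjnt_iff by metis
    then obtain n where "k x n < 1" "k y n = 1" using sepr xy(2) by blast
    with xy(3) show False by simp
  qed
  have om: "open_map Z (top_of_set (k ` topspace Z)) k"
    unfolding open_map_def
  proof (intro allI impI, subst openin_subopen, intro ballI)
    fix W y assume W: "openin Z W" and "y \<in> k ` W"
    then obtain z where z: "z \<in> W" "y = k z" by blast
    from sepr[OF W z(1)] obtain n where n: "k z n < 1" "\<And>y. y \<in> topspace Z - W \<Longrightarrow> k y n = 1" by blast
    have "open {s :: nat \<Rightarrow> real. s n < 1}"
      by (intro open_Collect_less continuous_intros) (rule continuous_on_product_coordinates)
    moreover have "z \<in> topspace Z" using W z openin_subset by blast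
    ultimately show "\<exists>T. openin (top_of_set (k ` topspace Z)) T \<and> y \<in> T \<and> T \<subseteq> k ` W"
      using n z by (intro exI[of _ "k ` topspace Z \<inter> {s. s n < 1}"]) fastforce
  qed
  have "embedding_map Z (top_of_set (k ` topspace Z)) k"
    by (rule injective_open_imp_embedding_map) (use kc om inj in \<open>auto simp: continuous_map_in_subtopology\<close>)
  then show ?thesis by (auto simp: embedding_map_in_subtopology)
qed

text \<open>
  This is the real completeness of second countable Tychonoff spaces, in the form of the extension
  property.  View \<open>Z\<close> as a set of real sequences and extend the coordinates of \<open>f\<close>.  The
  resulting \<open>F\<close> stays in \<open>Z\<close>: were \<open>F u\<close> outside \<open>Z\<close>, the reciprocal of the distance of \<open>f x\<close> to
  \<open>F u\<close> would be a continuous function on \<open>X\<close>, but it has no finite value to take at \<open>u\<close>.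
\<close>

lemma extend_into_second_countable:
  fixes Z :: "'c topology"
  assumes Z: "Tychonoff_space Z" "second_countable Z" and f: "continuous_map X Z f"
    and dense: "U closure_of (e ` topspace X) = topspace U"
    and ext: "\<And>h. continuous_map X euclideanreal h \<Longrightarrow>
       \<exists>g. continuous_map U euclideanreal g \<and> (\<forall>x \<in> topspace X. g (e x) = h x)"
  shows "\<exists>g. continuous_map U Z g \<and> (\<forall>x \<in> topspace X. g (e x) = f x)"
proof -
  obtain k :: "'c \<Rightarrow> nat \<Rightarrow> real" where "embedding_map Z euclidean k"
    using second_countable_embeds_in_real_sequences[OF Z] by blast
  then obtain k' where kk: "homeomorphic_maps Z (top_of_set (k ` topspace Z)) k k'"
    by (auto simp: embedding_map_def homeomorphic_map_maps)
  have fZ: "f x \<in> topspace Z" if "x \<in> topspace X" for x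
    using f that continuous_map_funspace by fastforce
  have "continuous_map Z euclidean k"
    using kk by (simp add: homeomorphic_maps_def continuous_map_in_subtopology)
  then have kfc: "continuous_map X euclidean (\<lambda>x. k (f x))"
    using continuous_map_compose[OF f] by (simp add: o_def)
  then have "continuous_map X euclideanreal (\<lambda>x. k (f x) n)" for n
    unfolding euclidean_product_topology [symmetric] continuous_map_componentwise_UNIV by simp
  then have "\<exists>g. continuous_map U euclideanreal g \<and> (\<forall>x \<in> topspace X. g (e x) = k (f x) n)" for n
    by (rule ext)
  then obtain G where G: "\<And>n. continuous_map U euclideanreal (G n)"
    "\<And>n x. x \<in> topspace X \<Longrightarrow> G n (e x) = k (f x) n"
    by metis
  define F where "F = (\<lambda>u n. G n u)"
  have Fc: "continuous_map U euclidean F"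
    unfolding euclidean_product_topology [symmetric] continuous_map_componentwise_UNIV F_def
    using G(1) by simp
  have Fe: "F (e x) = k (f x)" if "x \<in> topspace X" for x
    using G(2)[OF that] by (auto simp: F_def)
  have distc: "continuous_map T euclideanreal (\<lambda>t. dist (h t) a)"
    if "continuous_map T euclidean h" for T :: "'t topology" and h and a :: "nat \<Rightarrow> real"
    using continuous_map_compose[OF that, of euclideanreal "\<lambda>s. dist s a"]
    by (simp add: o_def continuous_intros)
  have "F u \<in> k ` topspace Z" if u: "u \<in> topspace U" for u
  proof (rule ccontr)
    assume "F u \<notin> k ` topspace Z"
    then have pos: "dist (k (f x)) (F u) \<noteq> 0" if "x \<in> topspace X" for x
      using fZ[OF that] by force
    have "continuous_map X euclideanreal (\<lambda>x. inverse (dist (k (f x)) (F u)))"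
      by (intro continuous_map_real_inverse distc kfc pos)
    from ext[OF this] obtain H where H: "continuous_map U euclideanreal H"
      "\<And>x. x \<in> topspace X \<Longrightarrow> H (e x) = inverse (dist (k (f x)) (F u))"
      by blast
    \<comment> \<open>The product \<open>H u' * dist (F u') (F u)\<close> is 1 on a dense set, hence also at \<open>u' = u\<close>.\<close>
    have "H u * dist (F u) (F u) = 1"
    proof (rule forall_in_closure_of_eq[of u U "e ` topspace X" euclideanreal "\<lambda>u'. H u' * dist (F u') (F u)"])
      show "continuous_map U euclideanreal (\<lambda>u'. H u' * dist (F u') (F u))"
        by (intro continuous_map_real_mult H(1) distc Fc)
    qed (use u dense H(2) Fe pos in auto)
    then show False by simp
  qed
  then have "continuous_map U (top_of_set (k ` topspace Z)) F"
    using Fc by (auto simp: continuous_map_in_subtopology)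
  then have "continuous_map U Z (k' \<circ> F)"
    using kk continuous_map_compose unfolding homeomorphic_maps_def by blast
  moreover have "k' (F (e x)) = f x" if "x \<in> topspace X" for x
    using Fe fZ kk that by (simp add: homeomorphic_maps_def)
  ultimately show ?thesis by (intro exI[of _ "k' \<circ> F"]) auto
qed

section \<open>Factoring functions on the square through an open map\<close>

lemma open_map_prod:
  assumes p: "open_map X X' p" and q: "open_map Y Y' q"
  shows "open_map (prod_topology X Y) (prod_topology X' Y') (map_prod p q)"
  unfolding open_map_def
proof (intro allI impI, subst openin_subopen, intro ballI)
  fix W z assume W: "openin (prod_topology X Y) W" and "z \<in> map_prod p q ` W"
  then obtain x y where xy: "(x, y) \<in> W" "z = (p x, q y)" by auto
  with W obtain A B where AB: "openin X A" "openin Y B" "x \<in> A" "y \<in> B" "A \<times> B \<subseteq> W"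
    unfolding openin_prod_topology_alt by meson
  then have "openin (prod_topology X' Y') (p ` A \<times> q ` B)"
    using p q by (simp add: open_map_def openin_prod_Times_iff)
  moreover have "p ` A \<times> q ` B \<subseteq> map_prod p q ` W"
    using AB(5) by (force simp: image_iff)
  ultimately show "\<exists>T. openin (prod_topology X' Y') T \<and> z \<in> T \<and> T \<subseteq> map_prod p q ` W"
    using AB xy by (intro exI[of _ "p ` A \<times> q ` B"]) auto
qed

text \<open>
  The saturated families \<open>\<G>\<close> of small oscillation need not cover \<open>a\<close> or \<open>b\<close>; their unions are only dense.  The points whose fibre meets both a neighbourhood of \<open>a\<close> and a
  neighbourhood of \<open>b\<close> form an open set because \<open>P\<close> is open, and this set contains \<open>a\<close>.  So it
  meets some \<open>G \<in> \<G>\<close>, and by saturation \<open>G\<close> contains a point near \<open>a\<close> and a point near \<open>b\<close>.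
\<close>

lemma constant_on_fibres_of_open_map:
  fixes f :: "'a \<Rightarrow> 'b::metric_space"
  assumes P: "continuous_map T T' P" "open_map T T' P" and f: "continuous_map T euclidean f"
    and small: "\<And>\<epsilon>. 0 < \<epsilon> \<Longrightarrow> \<exists>\<G>. T closure_of \<Union>\<G> = topspace T \<and>
      (\<forall>G \<in> \<G>. (\<forall>s \<in> G. \<forall>t \<in> G. dist (f s) (f t) < \<epsilon>) \<and>
                (\<forall>s \<in> G. \<forall>t \<in> topspace T. P t = P s \<longrightarrow> t \<in> G))"
    and ab: "a \<in> topspace T" "b \<in> topspace T" "P a = P b"
  shows "f a = f b"
proof (rule ccontr)
  assume ne: "f a \<noteq> f b"
  \<comment> \<open>One third each for the distances from \<open>f a\<close> to \<open>f a'\<close>, \<open>f a'\<close> to \<open>f b'\<close>, and \<open>f b'\<close> to \<open>f b\<close>.\<close>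
  define \<epsilon> where "\<epsilon> = dist (f a) (f b) / 3"
  have \<epsilon>: "\<epsilon> > 0" using ne by (simp add: \<epsilon>_def)
  obtain \<G> where dense: "T closure_of \<Union>\<G> = topspace T"
    and osc: "\<And>G s t. G \<in> \<G> \<Longrightarrow> s \<in> G \<Longrightarrow> t \<in> G \<Longrightarrow> dist (f s) (f t) < \<epsilon>"
    and sat: "\<And>G s t. G \<in> \<G> \<Longrightarrow> s \<in> G \<Longrightarrow> t \<in> topspace T \<Longrightarrow> P t = P s \<Longrightarrow> t \<in> G"
    using small[OF \<epsilon>] by metis
  define O' where "O' = (\<lambda>c. {t \<in> topspace T. f t \<in> ball (f c) \<epsilon>})"
  have O': "openin T (O' c)" for c
    unfolding O'_def using f by (rule openin_continuous_map_preimage) auto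
  define N where "N = {t \<in> topspace T. P t \<in> P ` O' a \<inter> P ` O' b}"
  have "openin T N"
    unfolding N_def
    by (rule openin_continuous_map_preimage[OF P(1)]) (use P(2) O' in \<open>auto simp: open_map_def\<close>)
  moreover have "a \<in> N"
  proof -
    have "a \<in> O' a" "b \<in> O' b" using ab \<epsilon> by (auto simp: O'_def)
    then have "P a \<in> P ` O' a \<inter> P ` O' b" using ab(3) by blast
    then show ?thesis using ab(1) by (simp add: N_def)
  qed
  moreover have "a \<in> T closure_of \<Union>\<G>" using ab dense by simp
  ultimately obtain w where w: "w \<in> N" "w \<in> \<Union>\<G>"
    unfolding in_closure_of by blast
  then obtain G where G: "G \<in> \<G>" "w \<in> G" by blast
  from w(1) obtain a' b' where a': "a' \<in> O' a" "P a' = P w" and b': "b' \<in> O' b" "P b' = P w"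
    unfolding N_def by auto
  have "a' \<in> G" "b' \<in> G"
    using sat[OF G] a' b' by (auto simp: O'_def)
  then have "dist (f a') (f b') < \<epsilon>" using osc[OF G(1)] by blast
  moreover have "dist (f a) (f a') < \<epsilon>" "dist (f b) (f b') < \<epsilon>"
    using a' b' by (auto simp: O'_def)
  ultimately have "dist (f a) (f b) < 3 * \<epsilon>"
    using dist_triangle[of "f a" "f b" "f a'"] dist_triangle[of "f a'" "f b" "f b'"]
    by (simp add: dist_commute)
  then show False by (simp add: \<epsilon>_def)
qed

text \<open>
  The functions of the family are the coordinates of a single map into the second countable space of real
  sequences, to which open factorizability applies.
\<close>

lemma openly_factorizable_countable_family:
  fixes X :: "'a topology" and \<Phi> :: "('a \<Rightarrow> real) set"
  assumes X: "openly_factorizable_space X" and \<Phi>: "countable \<Phi>"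
    and cont: "\<And>u. u \<in> \<Phi> \<Longrightarrow> continuous_map X euclideanreal u"
  obtains Z :: "real topology" and p where "Tychonoff_space Z" "second_countable Z"
    "continuous_map X Z p" "open_map X Z p" "p ` topspace X = topspace Z"
    "\<forall>u \<in> \<Phi>. \<forall>x \<in> topspace X. \<forall>y \<in> topspace X. p x = p y \<longrightarrow> u x = u y"
proof -
  \<comment> \<open>Inserting the zero function makes the enumeration meaningful for an empty family.\<close>
  define q where "q = (\<lambda>x n. from_nat_into (insert (\<lambda>_. 0) \<Phi>) n x)"
  have q: "continuous_map X (euclidean :: (nat \<Rightarrow> real) topology) q"
    unfolding euclidean_product_topology [symmetric] continuous_map_componentwise_UNIV q_def
  proof
    fix n
    have "from_nat_into (insert (\<lambda>_. 0) \<Phi>) n \<in> insert (\<lambda>_. 0) \<Phi>"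
      by (rule from_nat_into) simp
    then show "continuous_map X euclideanreal (\<lambda>x. from_nat_into (insert (\<lambda>_. 0) \<Phi>) n x)"
      using cont by auto
  qed
  have "Tychonoff_space (euclidean :: (nat \<Rightarrow> real) topology)"
    by (simp add: Tychonoff_space_def metrizable_imp_completely_regular_space metrizable_space_euclidean)
  moreover have "second_countable (euclidean :: (nat \<Rightarrow> real) topology)"
  proof -
    obtain \<B> :: "(nat \<Rightarrow> real) set set" where "countable \<B>" "topological_basis \<B>"
      using ex_countable_basis by blast
    then show ?thesis
      unfolding second_countable_def by (metis open_openin topological_basis_open topological_basisE)
  qed
  ultimately obtain Z :: "real topology" and p g where Z: "Tychonoff_space Z" "second_countable Z"
    "continuous_map X Z p" "open_map X Z p" "p ` topspace X = topspace Z"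
    and g: "continuous_map Z (euclidean :: (nat \<Rightarrow> real) topology) g" "\<And>x. x \<in> topspace X \<Longrightarrow> q x = g (p x)"
    by (rule openly_factorizable_spaceD[OF X _ _ q, THEN exE]) (elim exE conjE, rule that; (assumption | erule bspec))
  have "u x = u y" if u: "u \<in> \<Phi>" and xy: "x \<in> topspace X" "y \<in> topspace X" "p x = p y" for u x y
  proof -
    obtain n where "from_nat_into (insert (\<lambda>_. 0) \<Phi>) n = u"
      using from_nat_into_surj[of "insert (\<lambda>_. 0) \<Phi>" u] \<Phi> u by auto
    moreover have "q x n = q y n" using g(2) xy by simp
    ultimately show ?thesis by (simp add: q_def)
  qed
  then show ?thesis by (intro that[OF Z]) blast
qed

text \<open>
  The condition \<open>u x < 1\<close> describes the cozero set of \<open>max 0 (1 - u)\<close>.  A box is given by its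
  pair of functions, since it is these that are later factored through an open map.
\<close>

definition cozero_box :: "'a topology \<Rightarrow> ('a \<Rightarrow> real) \<times> ('a \<Rightarrow> real) \<Rightarrow> ('a \<times> 'a) set" where
  "cozero_box X = (\<lambda>(u, v). {x \<in> topspace X. u x < 1} \<times> {x \<in> topspace X. v x < 1})"

text \<open>
  Complete regularity makes the boxes of small oscillation a cover of the square, from which weak
  Lindelofness selects.
\<close>

lemma countably_many_dense_small_boxes:
  fixes f :: "'a \<times> 'a \<Rightarrow> 'b::metric_space"
  assumes X: "completely_regular_space X" and wL: "weakly_Lindelof_space (prod_topology X X)"
    and f: "continuous_map (prod_topology X X) euclidean f" and \<epsilon>: "0 < \<epsilon>"
  shows "\<exists>\<C>. countable \<C> \<and>
      (\<forall>(u, v) \<in> \<C>. continuous_map X euclideanreal u \<and> continuous_map X euclideanreal v) \<and>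
      (\<forall>c \<in> \<C>. \<forall>s \<in> cozero_box X c. \<forall>t \<in> cozero_box X c. dist (f s) (f t) < \<epsilon>) \<and>
      prod_topology X X closure_of \<Union>(cozero_box X ` \<C>) = topspace (prod_topology X X)"
proof -
  let ?T = "prod_topology X X"
  define \<D> where "\<D> = {(u, v). continuous_map X euclideanreal u \<and> continuous_map X euclideanreal v \<and>
    (\<forall>s \<in> cozero_box X (u, v). \<forall>t \<in> cozero_box X (u, v). dist (f s) (f t) < \<epsilon>)}"
  have op: "openin ?T (cozero_box X c)" if "c \<in> \<D>" for c
  proof -
    obtain u v where c: "c = (u, v)" by (cases c)
    with that have uv: "continuous_map X euclideanreal u" "continuous_map X euclideanreal v"
      by (auto simp: \<D>_def)
    have "openin X {x \<in> topspace X. w x \<in> {..<1}}" if "continuous_map X euclideanreal w" for w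
      using that by (rule openin_continuous_map_preimage) auto
    from this[OF uv(1)] this[OF uv(2)] show ?thesis
      by (simp add: c cozero_box_def openin_prod_Times_iff)
  qed
  have cov: "\<Union>(cozero_box X ` \<D>) = topspace ?T"
  proof
    show "\<Union>(cozero_box X ` \<D>) \<subseteq> topspace ?T"
      using op openin_subset by blast
    show "topspace ?T \<subseteq> \<Union>(cozero_box X ` \<D>)"
    proof
      fix a assume a: "a \<in> topspace ?T"
      obtain x y where xy: "a = (x, y)" by (cases a)
      define N where "N = {t \<in> topspace ?T. f t \<in> ball (f a) (\<epsilon>/2)}"
      have "openin ?T N"
        unfolding N_def using f by (rule openin_continuous_map_preimage) auto
      moreover have "(x, y) \<in> N" using a \<epsilon> by (simp add: N_def xy)
      ultimately obtain A B where AB: "openin X A" "openin X B" "x \<in> A" "y \<in> B" "A \<times> B \<subseteq> N"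
        unfolding openin_prod_topology_alt by meson
      obtain u where u: "continuous_map X euclideanreal u" "u x = 0" "u ` (topspace X - A) \<subseteq> {1}"
        using X AB unfolding completely_regular_space_alt' by meson
      obtain v where v: "continuous_map X euclideanreal v" "v y = 0" "v ` (topspace X - B) \<subseteq> {1}"
        using X AB unfolding completely_regular_space_alt' by meson
      have "cozero_box X (u, v) \<subseteq> A \<times> B"
      proof (clarsimp simp: cozero_box_def, intro conjI)
        fix a b assume "a \<in> topspace X" "u a < 1" "b \<in> topspace X" "v b < 1"
        then show "a \<in> A" "b \<in> B" using u(3) v(3) by (force simp: image_subset_iff)+
      qed
      then have sub: "cozero_box X (u, v) \<subseteq> N" using AB(5) by blast
      have "dist (f s) (f t) < \<epsilon>" if "s \<in> cozero_box X (u, v)" "t \<in> cozero_box X (u, v)" for s t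
      proof -
        have "dist (f a) (f s) < \<epsilon>/2" "dist (f a) (f t) < \<epsilon>/2"
          using that sub by (auto simp: N_def)
        then show ?thesis by (metis dist_commute dist_triangle_half_l)
      qed
      then have "(u, v) \<in> \<D>" using u v by (auto simp: \<D>_def)
      moreover have "a \<in> cozero_box X (u, v)"
        using a u v by (simp add: cozero_box_def xy)
      ultimately show "a \<in> \<Union>(cozero_box X ` \<D>)" by blast
    qed
  qed
  obtain \<V> where \<V>: "\<V> \<subseteq> cozero_box X ` \<D>" "countable \<V>" "?T closure_of \<Union>\<V> = topspace ?T"
    using wL op cov unfolding weakly_Lindelof_space_def by (metis (no_types, lifting) imageE)
  then obtain \<C> where "\<C> \<subseteq> \<D>" "countable \<C>" "\<V> = cozero_box X ` \<C>"
    by (metis countable_subset_image)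
  with \<V>(3) show ?thesis
    by (intro exI[of _ \<C>]) (auto simp: \<D>_def)
qed

text \<open>
  Let \<open>\<Phi>\<close> consist of all functions that define the selected boxes, for every oscillation bound
  \<open>1/(n+1)\<close>.  Once each function in \<open>\<Phi>\<close> is constant on the fibres of \<open>p\<close>, the
  boxes are saturated for \<open>p \<times> p\<close>, hence \<open>f\<close> is constant on the fibres of \<open>p \<times> p\<close>.  A
  product of open surjections is a quotient map, so \<open>f\<close> descends to a continuous function.
\<close>

lemma square_function_factors:
  fixes X :: "'a topology" and f :: "'a \<times> 'a \<Rightarrow> 'b::metric_space"
  assumes X: "completely_regular_space X" "openly_factorizable_space X"
    and wL: "weakly_Lindelof_space (prod_topology X X)"
    and f: "continuous_map (prod_topology X X) euclidean f"
  obtains Z :: "real topology" and p g where "Tychonoff_space Z" "second_countable Z"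
    "continuous_map X Z p" "continuous_map (prod_topology Z Z) euclidean g"
    "\<forall>x \<in> topspace X. \<forall>y \<in> topspace X. f (x, y) = g (p x, p y)"
proof -
  let ?T = "prod_topology X X"
  define good where "good = (\<lambda>n \<C>. countable \<C> \<and>
      (\<forall>(u, v) \<in> \<C>. continuous_map X euclideanreal u \<and> continuous_map X euclideanreal v) \<and>
      (\<forall>c \<in> \<C>. \<forall>s \<in> cozero_box X c. \<forall>t \<in> cozero_box X c. dist (f s) (f t) < inverse (real (Suc n))) \<and>
      ?T closure_of \<Union>(cozero_box X ` \<C>) = topspace ?T)"
  have "\<exists>\<C>. good n \<C>" for n
    unfolding good_def by (intro countably_many_dense_small_boxes X wL f) simp
  then obtain \<C> where good: "\<And>n. good n (\<C> n)" by metis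
  have \<C>: "\<And>n. countable (\<C> n)"
    "\<And>n u v. (u, v) \<in> \<C> n \<Longrightarrow> continuous_map X euclideanreal u \<and> continuous_map X euclideanreal v"
    "\<And>n c s t. c \<in> \<C> n \<Longrightarrow> s \<in> cozero_box X c \<Longrightarrow> t \<in> cozero_box X c \<Longrightarrow>
       dist (f s) (f t) < inverse (real (Suc n))"
    "\<And>n. ?T closure_of \<Union>(cozero_box X ` \<C> n) = topspace ?T"
    using good unfolding good_def by blast+
  define \<Phi> where "\<Phi> = (\<Union>n. fst ` \<C> n \<union> snd ` \<C> n)"
  have "countable \<Phi>" using \<C>(1) by (auto simp: \<Phi>_def)
  moreover have "continuous_map X euclideanreal u" if "u \<in> \<Phi>" for u
    using that \<C>(2) by (force simp: \<Phi>_def)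
  ultimately obtain Z :: "real topology" and p where Z: "Tychonoff_space Z" "second_countable Z"
    and p: "continuous_map X Z p" "open_map X Z p" "p ` topspace X = topspace Z"
    and fib: "\<forall>u \<in> \<Phi>. \<forall>x \<in> topspace X. \<forall>y \<in> topspace X. p x = p y \<longrightarrow> u x = u y"
    by (rule openly_factorizable_countable_family[OF X(2)])
  let ?P = "map_prod p p" and ?T' = "prod_topology Z Z"
  have Pc: "continuous_map ?T ?T' ?P"
    using p(1) by (simp add: map_prod_def continuous_map_prod_top)
  have Po: "open_map ?T ?T' ?P" by (rule open_map_prod[OF p(2) p(2)])
  have "quotient_map ?T ?T' ?P"
    by (rule continuous_open_imp_quotient_map[OF Pc Po]) (use p(3) in \<open>simp add: map_prod_surj_on\<close>)
  moreover have "f a = f b" if "a \<in> topspace ?T" "b \<in> topspace ?T" "?P a = ?P b" for a b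
  proof (rule constant_on_fibres_of_open_map[OF Pc Po f _ that])
    fix \<epsilon> :: real assume "0 < \<epsilon>"
    then obtain n where n: "inverse (real (Suc n)) < \<epsilon>" using reals_Archimedean by blast
    have "t \<in> cozero_box X c"
      if c: "c \<in> \<C> n" and s: "s \<in> cozero_box X c" and t: "t \<in> topspace ?T" "?P t = ?P s" for c s t
    proof -
      obtain u v where uv: "c = (u, v)" by (cases c)
      have "u \<in> \<Phi>" "v \<in> \<Phi>" using c by (force simp: \<Phi>_def uv)+
      then show ?thesis
        using s t fib[rule_format, of u "fst t" "fst s"] fib[rule_format, of v "snd t" "snd s"]
        by (cases s; cases t) (auto simp: cozero_box_def uv)
    qed
    moreover have "dist (f s) (f t) < \<epsilon>"
      if "c \<in> \<C> n" "s \<in> cozero_box X c" "t \<in> cozero_box X c" for c s t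
      using \<C>(3)[OF that] n by linarith
    ultimately show "\<exists>\<G>. ?T closure_of \<Union>\<G> = topspace ?T \<and>
      (\<forall>G \<in> \<G>. (\<forall>s \<in> G. \<forall>t \<in> G. dist (f s) (f t) < \<epsilon>) \<and>
                (\<forall>s \<in> G. \<forall>t \<in> topspace ?T. ?P t = ?P s \<longrightarrow> t \<in> G))"
      using \<C>(4)[of n] by (intro exI[of _ "cozero_box X ` \<C> n"]) blast
  qed
  ultimately obtain g where g: "continuous_map ?T' euclidean g" "\<And>t. t \<in> topspace ?T \<Longrightarrow> g (?P t) = f t"
    using quotient_map_lift_exists[OF _ f] by metis
  have "f (x, y) = g (p x, p y)" if "x \<in> topspace X" "y \<in> topspace X" for x y
    using g(2)[of "(x, y)"] that by simp
  then show ?thesis by (intro that[OF Z p(1) g(1)]) blast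
qed

section \<open>Extending the semigroup operation\<close>

lemma square_function_extends_to_Hewitt_completion:
  fixes X :: "'a topology" and f :: "'a \<times> 'a \<Rightarrow> 'c::metric_space"
  assumes X: "completely_regular_space X" "openly_factorizable_space X"
    and wL: "weakly_Lindelof_space (prod_topology X X)" and H: "Hewitt_completion X U e"
    and f: "continuous_map (prod_topology X X) euclidean f"
  shows "\<exists>g. continuous_map (prod_topology U U) euclidean g \<and>
             (\<forall>t \<in> topspace (prod_topology X X). g (map_prod e e t) = f t)"
proof -
  obtain Z :: "real topology" and p g where Z: "Tychonoff_space Z" "second_countable Z"
    and p: "continuous_map X Z p" and g: "continuous_map (prod_topology Z Z) euclidean g"
    "\<forall>x \<in> topspace X. \<forall>y \<in> topspace X. f (x, y) = g (p x, p y)"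
    by (rule square_function_factors[OF X wL f])
  have "U closure_of (e ` topspace X) = topspace U"
    using H by (simp add: Hewitt_completion_def)
  then obtain p' where p': "continuous_map U Z p'" "\<And>x. x \<in> topspace X \<Longrightarrow> p' (e x) = p x"
    using extend_into_second_countable[OF Z p _ Hewitt_completion_extend_real[OF H]] by blast
  have "continuous_map (prod_topology U U) (prod_topology Z Z) (map_prod p' p')"
    using p'(1) by (simp add: map_prod_def continuous_map_prod_top)
  then have "continuous_map (prod_topology U U) euclidean (g \<circ> map_prod p' p')"
    using g(1) by (rule continuous_map_compose)
  then show ?thesis
    using g(2) p'(2) by (intro exI[of _ "g \<circ> map_prod p' p'"]) auto
qed

text \<open>
  Real completeness of \<open>U\<close> reduces the extension of the operation to that of its real coordinates,
  which are functions on the square of \<open>S\<close>.  Both sides of the associative law are continuous on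
  the cube of \<open>U\<close> and agree on the dense image of the cube of \<open>S\<close>.
\<close>

theorem theorem1p8:
  fixes S :: "'a topology" and m :: "'a \<Rightarrow> 'a \<Rightarrow> 'a"
    and U :: "'b topology" and e :: "'a \<Rightarrow> 'b"
  assumes "topological_semigroup S m"
    and "openly_factorizable_space S"
    and "weakly_Lindelof_space (prod_topology S S)"
    and "Hewitt_completion S U e"
  shows "\<exists>m'. topological_semigroup U m' \<and>
              (\<forall>x \<in> topspace S. \<forall>y \<in> topspace S. m' (e x) (e y) = e (m x y))"
proof -
  let ?S2 = "prod_topology S S" and ?U2 = "prod_topology U U"
  have mc: "continuous_map ?S2 S (\<lambda>(x, y). m x y)" and TS: "Tychonoff_space S"
    and assoc: "\<And>x y z. x \<in> topspace S \<Longrightarrow> y \<in> topspace S \<Longrightarrow> z \<in> topspace S \<Longrightarrow>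
      m (m x y) z = m x (m y z)"
    using assms(1) by (auto simp: topological_semigroup_def)
  have rc: "real_complete_space U" and dense: "U closure_of (e ` topspace S) = topspace U"
    and "embedding_map S U e"
    using assms(4) by (auto simp: Hewitt_completion_def)
  then have ec: "continuous_map S U e"
    using homeomorphic_imp_continuous_map continuous_map_in_subtopology unfolding embedding_map_def by blast
  have eU: "e x \<in> topspace U" if "x \<in> topspace S" for x
    using ec that continuous_map_funspace by fastforce
  have mS: "m x y \<in> topspace S" if "x \<in> topspace S" "y \<in> topspace S" for x y
    using continuous_map_funspace[OF mc] that by (auto simp: Pi_iff)
  have TU: "Tychonoff_space U" by (rule real_complete_space_Tychonoff[OF rc])
  then have hU: "Hausdorff_space U" by (simp add: Tychonoff_space_def)
  have "\<exists>M. continuous_map ?U2 U M \<and>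
    (\<forall>t \<in> topspace ?S2. M (map_prod e e t) = (e \<circ> (\<lambda>(x, y). m x y)) t)"
  proof (rule extend_into_real_complete[OF rc continuous_map_compose[OF mc ec]])
    show "?U2 closure_of (map_prod e e ` topspace ?S2) = topspace ?U2"
      using dense by (simp add: map_prod_surj_on closure_of_Times)
    show "map_prod e e ` topspace ?S2 \<subseteq> topspace ?U2" using eU by auto
  next
    fix h assume "continuous_map ?S2 euclideanreal h"
    then show "\<exists>g. continuous_map ?U2 euclideanreal g \<and> (\<forall>t \<in> topspace ?S2. g (map_prod e e t) = h t)"
      using TS unfolding Tychonoff_space_def
      by (intro square_function_extends_to_Hewitt_completion assms) auto
  qed
  then obtain M where M: "continuous_map ?U2 U M"
    and Me: "\<And>x y. x \<in> topspace S \<Longrightarrow> y \<in> topspace S \<Longrightarrow> M (e x, e y) = e (m x y)"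
    by fastforce
  have Mcomp: "continuous_map T U (\<lambda>t. M (a t, b t))"
    if "continuous_map T U a" "continuous_map T U b" for T :: "('b \<times> 'b \<times> 'b) topology" and a b
    using continuous_map_compose[OF continuous_map_pairedI[OF that] M] by (simp add: o_def)
  let ?U3 = "prod_topology U ?U2"
  have "M (M (u, v), w) = M (u, M (v, w))"
    if "u \<in> topspace U" "v \<in> topspace U" "w \<in> topspace U" for u v w
  proof -
    let ?l = "\<lambda>t. M (M (fst t, fst (snd t)), snd (snd t))"
    let ?r = "\<lambda>t. M (fst t, M (fst (snd t), snd (snd t)))"
    let ?D = "e ` topspace S"
    have pr: "continuous_map ?U3 U fst" "continuous_map ?U3 U (fst \<circ> snd)" "continuous_map ?U3 U (snd \<circ> snd)"
      using continuous_map_compose[OF continuous_map_snd continuous_map_fst]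
        continuous_map_compose[OF continuous_map_snd continuous_map_snd]
      by (blast intro: continuous_map_fst)+
    have "?l (u, v, w) = ?r (u, v, w)"
    proof (rule forall_in_closure_of_eq[where f = ?l and g = ?r, OF _ hU])
      show "(u, v, w) \<in> ?U3 closure_of (?D \<times> ?D \<times> ?D)"
        using that dense by (simp add: closure_of_Times)
      show "continuous_map ?U3 U ?l" "continuous_map ?U3 U ?r"
        by (intro Mcomp pr[unfolded o_def])+
      show "?l t = ?r t" if "t \<in> ?D \<times> ?D \<times> ?D" for t
        using that by (auto simp: Me mS assoc)
    qed
    then show ?thesis by simp
  qed
  then have "topological_semigroup U (\<lambda>u v. M (u, v))"
    using TU M by (simp add: topological_semigroup_def)
  with Me show ?thesis by (intro exI[of _ "\<lambda>u v. M (u, v)"]) blast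
qed

end
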